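(* For all cathoristic models $\mathfrak{M}$ and $\mathfrak{M}'$: (1) $\mathfrak{M}' \preceq \mathfrak{M}$ if and only if $\mathrm{Th}(\mathfrak{M}) \subseteq \mathrm{Th}(\mathfrak{M}')$; (2) $\mathfrak{M}' \simeq \mathfrak{M}$ if and only if $\mathrm{Th}(\mathfrak{M}) = \mathrm{Th}(\mathfrak{M}')$.
   Context: Fix a non-empty set $\Sigma$ of actions. Formulae of cathoristic logic are given by $\phi ::= \top \mid \phi \land \psi \mid \langle a\rangle \phi \mid\ !A$, where $a\in\Sigma$ and $A$ ranges over finite subsets of $\Sigma$. A cathoristic transition system is a triple $\mathcal{L}=(S,\rightarrow,\lambda)$ where $S$ is a set of states, $\rightarrow\subseteq S\times\Sigma\times S$ is deterministic ($s\xrightarrow{a}t$ and $s\xrightarrow{a}t'$ imply $t=t'$), and $\lambda$ maps each state to a subset of $\Sigma$, such that (admissibility) $\{a \mid \exists t.\, s\xrightarrow{a}t\}\subseteq\lambda(s)$ for every $s$, and (well-sizedness) every $\lambda(s)$ is either finite or equal to $\Sigma$. A cathoristic model is a pair $(\mathcal{L},s)$ with $s\in S$ (the start state). Satisfaction: $(\mathcal{L},s)\models\top$ always; $(\mathcal{L},s)\models\phi\land\psi$ iff both conjuncts hold; $(\mathcal{L},s)\models\langle a\rangle\phi$ iff there is $t$ with $s\xrightarrow{a}t$ and $(\mathcal{L},t)\models\phi$; $(\mathcal{L},s)\models\ !A$ iff $\lambda(s)\subseteq A$. The theory of a model is $\mathrm{Th}(\mathfrak{M})=\{\phi \mid \mathfrak{M}\models\phi\}$.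 For cathoristic transition systems $\mathcal{L}_i=(S_i,\rightarrow_i,\lambda_i)$, a simulation from $\mathcal{L}_1$ to $\mathcal{L}_2$ is a relation $R\subseteq S_1\times S_2$ such that whenever $(x,y)\in R$ and $x\xrightarrow{a}_1 x'$ there is $y'$ with $y\xrightarrow{a}_2 y'$ and $(x',y')\in R$, and moreover $\lambda_1(x)\supseteq\lambda_2(y)$ for all $(x,y)\in R$. A simulation from the model $(\mathcal{L}_1,s_1)$ to $(\mathcal{L}_2,s_2)$ is such an $R$ with $(s_1,s_2)\in R$. Write $\mathfrak{M}_1\preceq_{sim}\mathfrak{M}_2$ if there is a simulation from $\mathfrak{M}_1$ to $\mathfrak{M}_2$; define $\mathfrak{M}\preceq\mathfrak{M}'$ iff $\mathfrak{M}'\preceq_{sim}\mathfrak{M}$, and $\mathfrak{M}\simeq\mathfrak{M}'$ iff $\mathfrak{M}\preceq\mathfrak{M}'$ and $\mathfrak{M}'\preceq\mathfrak{M}$. *)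

theory Defs
  imports Main "HOL-Library.FSet"
begin

text \<open>The non-empty set \<open>\<Sigma>\<close> of actions is the type variable \<open>'a\<close>, so that \<open>\<Sigma>\<close> itself is
  \<open>UNIV :: 'a set\<close>.\<close>

datatype 'a form =
    Top
  | Conj "'a form" "'a form"
  | May 'a "'a form"
  | Bang "'a fset"

record ('s, 'a) cts =
  states :: "'s set"
  transitions :: "('s \<times> 'a \<times> 's) set"
  lab :: "'s \<Rightarrow> 'a set"

text \<open>\<open>lab\<close> is a total function on the type \<open>'s\<close>; its values outside \<open>states\<close> are
  unconstrained and never used.\<close>

definition cathoristic_ts :: "('s, 'a) cts \<Rightarrow> bool" where
  "cathoristic_ts L \<longleftrightarrow>
     transitions L \<subseteq> states L \<times> UNIV \<times> states L \<and>
     (\<forall>s a t t'. (s, a, t) \<in> transitions L \<and> (s, a, t') \<in> transitions L \<longrightarrow> t = t') \<and>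
     (\<forall>s \<in> states L. {a. \<exists>t. (s, a, t) \<in> transitions L} \<subseteq> lab L s) \<and>
     (\<forall>s \<in> states L. finite (lab L s) \<or> lab L s = UNIV)"

type_synonym ('s, 'a) model = "('s, 'a) cts \<times> 's"

definition cathoristic_model :: "('s, 'a) model \<Rightarrow> bool" where
  "cathoristic_model M \<longleftrightarrow> cathoristic_ts (fst M) \<and> snd M \<in> states (fst M)"

fun sat :: "('s, 'a) model \<Rightarrow> 'a form \<Rightarrow> bool" (infix "\<Turnstile>" 50) where
  "(L, s) \<Turnstile> Top \<longleftrightarrow> True"
| "(L, s) \<Turnstile> Conj \<phi> \<psi> \<longleftrightarrow> (L, s) \<Turnstile> \<phi> \<and> (L, s) \<Turnstile> \<psi>"
| "(L, s) \<Turnstile> May a \<phi> \<longleftrightarrow> (\<exists>t. (s, a, t) \<in> transitions L \<and> (L, t) \<Turnstile> \<phi>)"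
| "(L, s) \<Turnstile> Bang A \<longleftrightarrow> lab L s \<subseteq> fset A"

definition Th :: "('s, 'a) model \<Rightarrow> 'a form set" where
  "Th M = {\<phi>. M \<Turnstile> \<phi>}"

definition ts_simulation :: "('s, 'a) cts \<Rightarrow> ('t, 'a) cts \<Rightarrow> ('s \<times> 't) set \<Rightarrow> bool" where
  "ts_simulation L\<^sub>1 L\<^sub>2 R \<longleftrightarrow>
     R \<subseteq> states L\<^sub>1 \<times> states L\<^sub>2 \<and>
     (\<forall>x y a x'. (x, y) \<in> R \<and> (x, a, x') \<in> transitions L\<^sub>1 \<longrightarrow>
        (\<exists>y'. (y, a, y') \<in> transitions L\<^sub>2 \<and> (x', y') \<in> R)) \<and>
     (\<forall>x y. (x, y) \<in> R \<longrightarrow> lab L\<^sub>1 x \<supseteq> lab L\<^sub>2 y)"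

definition model_simulation :: "('s, 'a) model \<Rightarrow> ('t, 'a) model \<Rightarrow> ('s \<times> 't) set \<Rightarrow> bool" where
  "model_simulation M\<^sub>1 M\<^sub>2 R \<longleftrightarrow>
     ts_simulation (fst M\<^sub>1) (fst M\<^sub>2) R \<and> (snd M\<^sub>1, snd M\<^sub>2) \<in> R"

definition sim_le :: "('s, 'a) model \<Rightarrow> ('t, 'a) model \<Rightarrow> bool" (infix "\<preceq>\<^sub>s\<^sub>i\<^sub>m" 50) where
  "M\<^sub>1 \<preceq>\<^sub>s\<^sub>i\<^sub>m M\<^sub>2 \<longleftrightarrow> (\<exists>R. model_simulation M\<^sub>1 M\<^sub>2 R)"

text \<open>Note the reversal: the smaller model is the one that simulates the other.\<close>

definition model_le :: "('s, 'a) model \<Rightarrow> ('t, 'a) model \<Rightarrow> bool" (infix "\<preceq>" 50) where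
  "M \<preceq> M' \<longleftrightarrow> M' \<preceq>\<^sub>s\<^sub>i\<^sub>m M"

definition model_equiv :: "('s, 'a) model \<Rightarrow> ('t, 'a) model \<Rightarrow> bool" (infix "\<simeq>" 50) where
  "M \<simeq> M' \<longleftrightarrow> M \<preceq> M' \<and> M' \<preceq> M"

end

theory Submission
  imports Defs
begin

text \<open>Satisfaction is preserved along simulations. Conversely, determinism makes inclusion of
  theories itself a simulation: the unique \<open>a\<close>-successor of the simulating state satisfies every
  formula of the simulated successor at once. For the labels, a finite \<open>\<lambda>(x)\<close> is captured by
  the formula \<open>!\<lambda>(x)\<close>, and otherwise well-sizedness gives \<open>\<lambda>(x) = \<Sigma>\<close>.\<close>

lemma sat_ts_simulation:
  assumes "ts_simulation L L' R" and "(x, y) \<in> R" and "(L, x) \<Turnstile> \<phi>"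
  shows "(L', y) \<Turnstile> \<phi>"
  using assms(2,3)
proof (induction \<phi> arbitrary: x y)
  case (May a \<phi>)
  then obtain x' where "(x, a, x') \<in> transitions L" "(L, x') \<Turnstile> \<phi>"
    by auto
  with May assms(1) show ?case
    unfolding ts_simulation_def sat.simps by blast
next
  \<comment> \<open>Labels shrink along a simulation, so a bound \<open>A\<close> on the label of
    \<open>x\<close> also bounds that of \<open>y\<close>.\<close>
  case (Bang A)
  with assms(1) show ?case
    unfolding ts_simulation_def sat.simps by blast
qed auto

text \<open>By \<open>sat_ts_simulation\<close> this relation contains every simulation from
  \<open>L\<close> to \<open>L'\<close>, so it is the largest one.\<close>

lemma ts_simulation_Th_subset:
  assumes L: "cathoristic_ts L" and L': "cathoristic_ts L'"
  shows "ts_simulation L L'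
    {(x, y). x \<in> states L \<and> y \<in> states L' \<and> Th (L, x) \<subseteq> Th (L', y)}"
    (is "ts_simulation L L' ?R")
  unfolding ts_simulation_def
proof (intro conjI allI impI)
  show "?R \<subseteq> states L \<times> states L'"
    by auto
next
  fix x y a x'
  assume "(x, y) \<in> ?R \<and> (x, a, x') \<in> transitions L"
  then have Th: "Th (L, x) \<subseteq> Th (L', y)" and x': "(x, a, x') \<in> transitions L"
    by auto
  \<comment> \<open>\<open>May a Top\<close> yields \<open>y'\<close> before any \<phi> is chosen;
    the later witness \<open>z\<close> may depend on \<phi>, and determinism of \<open>L'\<close>
    identifies it with \<open>y'\<close>.\<close>
  from x' have "May a Top \<in> Th (L, x)"
    by (auto simp: Th_def)
  with Th have "May a Top \<in> Th (L', y)"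
    by blast
  then obtain y' where y': "(y, a, y') \<in> transitions L'"
    by (auto simp: Th_def)
  have "Th (L, x') \<subseteq> Th (L', y')"
  proof
    fix \<phi>
    assume "\<phi> \<in> Th (L, x')"
    with x' have "May a \<phi> \<in> Th (L, x)"
      by (auto simp: Th_def)
    with Th have "May a \<phi> \<in> Th (L', y)"
      by blast
    then obtain z where "(y, a, z) \<in> transitions L'" "(L', z) \<Turnstile> \<phi>"
      by (auto simp: Th_def)
    moreover from this y' L' have "z = y'"
      unfolding cathoristic_ts_def by blast
    ultimately show "\<phi> \<in> Th (L', y')"
      by (simp add: Th_def)
  qed
  moreover have "x' \<in> states L" "y' \<in> states L'"
    using L L' x' y' unfolding cathoristic_ts_def by blast+
  ultimately show "\<exists>y'. (y, a, y') \<in> transitions L' \<and> (x', y') \<in> ?R"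
    using y' by blast
next
  fix x y
  assume "(x, y) \<in> ?R"
  then have x: "x \<in> states L" and Th: "Th (L, x) \<subseteq> Th (L', y)"
    by auto
  from L x consider "finite (lab L x)" | "lab L x = UNIV"
    unfolding cathoristic_ts_def by blast
  then show "lab L' y \<subseteq> lab L x"
  proof cases
    case 1
    \<comment> \<open>\<open>fset\<close> is known to invert \<open>Abs_fset\<close> only on finite
      sets, hence the case split.\<close>
    then have A: "fset (Abs_fset (lab L x)) = lab L x"
      by (simp add: Abs_fset_inverse)
    then have "Bang (Abs_fset (lab L x)) \<in> Th (L, x)"
      by (simp add: Th_def)
    with Th have "Bang (Abs_fset (lab L x)) \<in> Th (L', y)"
      by blast
    with A show ?thesis
      by (simp add: Th_def)
  qed simp
qed

text \<open>\<open>M' \<preceq> M\<close> unfolds to a simulation from \<open>M\<close> to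
  \<open>M'\<close>, the direction in which formulae are preserved. For the converse,
  \<open>Th M \<subseteq> Th M'\<close> says that the start states are related.\<close>

lemma model_le_iff_Th_subset:
  assumes "cathoristic_model M" and "cathoristic_model M'"
  shows "M' \<preceq> M \<longleftrightarrow> Th M \<subseteq> Th M'"
proof -
  obtain L s L' s' where M: "M = (L, s)" and M': "M' = (L', s')"
    by fastforce
  show ?thesis
  proof
    assume "M' \<preceq> M"
    then show "Th M \<subseteq> Th M'"
      unfolding M M' model_le_def sim_le_def model_simulation_def Th_def
      using sat_ts_simulation by fastforce
  next
    assume "Th M \<subseteq> Th M'"
    with assms show "M' \<preceq> M"
      unfolding M M' model_le_def sim_le_def model_simulation_def cathoristic_model_def
      using ts_simulation_Th_subset[of L L'] by auto
  qed
qed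

theorem mainTheorem1:
  fixes M :: "('s, 'a) model" and M' :: "('t, 'a) model"
  assumes "cathoristic_model M" and "cathoristic_model M'"
  shows "(M' \<preceq> M \<longleftrightarrow> Th M \<subseteq> Th M') \<and> (M' \<simeq> M \<longleftrightarrow> Th M = Th M')"
  unfolding model_equiv_def
  \<comment> \<open>Swapping the two models gives the reverse inclusion of theories.\<close>
  using model_le_iff_Th_subset[OF assms] model_le_iff_Th_subset[OF assms(2,1)] by auto

end
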